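(* Let $w \in S_n$ be a permutation and let $X$ be the BBS configuration corresponding to $w$. Then the rightmost soliton of the box-ball system containing $X$ is created after applying at most one BBS move to $X$ (that is, for all $t \ge 1$ the rightmost increasing run of $\mathrm{BB}^t(X)$ is equal to this rightmost soliton), and this rightmost soliton is equal to the first row of the Robinson--Schensted insertion tableau $P(w)$.
   Context: Box-ball system (BBS). Boxes are indexed by $\mathbb{Z}$ from left to right. A BBS configuration (with $n$ balls) is a sequence $X$ indexed by $\mathbb{Z}$ in which each of $1,\dots,n$ (the balls) appears exactly once and every other entry is $e := n+1$ (an empty box). One BBS move transforms $X$ into $\mathrm{BB}(X)$: the balls $1,2,\dots,n$, in this order, each jump once, to the nearest box to the right of the ball that is empty at that moment (the box a ball leaves becomes empty). $\mathrm{BB}^t(X)$ is the result of $t$ BBS moves. The configuration corresponding to a permutation $w = w_1\cdots w_n \in S_n$ (one-line notation) has ball $w_i$ in box $i$ for $1\le i\le n$ and all other boxes empty. An increasing run of a configuration is a maximal contiguous (occupying consecutive boxes) increasing nonempty sequence of balls. A soliton is an increasing run that is preserved by all subsequent BBS moves (it remains an increasing run in all later configurations). A configuration is in steady state if every ball is contained in a soliton. Every box-ball system reaches steady state after finitely many moves. The rightmost soliton of the box-ball system is the rightmost soliton of a configuration $\mathrm{BB}^t(X)$ that is in steady state (it does not depend on the choice of such $t$). *)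

theory Defs
  imports "HOL-Combinatorics.Permutations"
begin

text \<open>
  A configuration with \<open>n\<close> balls is a function \<open>X :: int \<Rightarrow> nat\<close> taking each of the values
  \<open>1, \<dots>, n\<close> exactly once and the value \<open>Suc n\<close> (an empty box) everywhere else.
\<close>

definition perm_config :: "nat \<Rightarrow> (nat \<Rightarrow> nat) \<Rightarrow> int \<Rightarrow> nat" where
  "perm_config n w p = (if 1 \<le> p \<and> p \<le> int n then w (nat p) else Suc n)"

text \<open>
  Both descriptions below have a unique solution whenever \<open>X\<close> is a configuration with \<open>n\<close> balls
  and \<open>1 \<le> i \<le> n\<close>, because then only finitely many boxes are occupied. The box \<open>p\<close> being left
  lies strictly to the left of the target, so it does not matter that \<open>q\<close> is computed in \<open>X\<close>.
\<close>

definition jump :: "nat \<Rightarrow> nat \<Rightarrow> (int \<Rightarrow> nat) \<Rightarrow> int \<Rightarrow> nat" where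
  "jump n i X =
     (let p = (THE p. X p = i);
          q = (LEAST q. p < q \<and> X q = Suc n)
      in X(p := Suc n, q := i))"

definition BB :: "nat \<Rightarrow> (int \<Rightarrow> nat) \<Rightarrow> int \<Rightarrow> nat" where
  "BB n X = fold (jump n) [1..<Suc n] X"

definition increasing_block :: "nat \<Rightarrow> (int \<Rightarrow> nat) \<Rightarrow> int \<Rightarrow> int \<Rightarrow> bool" where
  "increasing_block n X a b \<longleftrightarrow>
     a \<le> b \<and> (\<forall>p\<in>{a..b}. X p \<in> {1..n}) \<and> strict_mono_on {a..b} X"

definition increasing_run :: "nat \<Rightarrow> (int \<Rightarrow> nat) \<Rightarrow> int \<Rightarrow> int \<Rightarrow> bool" where
  "increasing_run n X a b \<longleftrightarrow>
     increasing_block n X a b \<and>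
     (\<forall>a' b'. increasing_block n X a' b' \<and> {a..b} \<subseteq> {a'..b'} \<longrightarrow> a' = a \<and> b' = b)"

text \<open>
  A run sits at the boxes \<open>a, \<dots>, b\<close>; what identifies it over time is its sequence of balls, which
  may move to other boxes.
\<close>

definition balls :: "(int \<Rightarrow> nat) \<Rightarrow> int \<Rightarrow> int \<Rightarrow> nat list" where
  "balls X a b = map X [a..b]"

definition soliton :: "nat \<Rightarrow> (int \<Rightarrow> nat) \<Rightarrow> int \<Rightarrow> int \<Rightarrow> bool" where
  "soliton n X a b \<longleftrightarrow>
     increasing_run n X a b \<and>
     (\<forall>t. \<exists>a' b'. increasing_run n ((BB n ^^ t) X) a' b' \<and>
                   balls ((BB n ^^ t) X) a' b' = balls X a b)"

definition steady_state :: "nat \<Rightarrow> (int \<Rightarrow> nat) \<Rightarrow> bool" where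
  "steady_state n X \<longleftrightarrow> (\<forall>i\<in>{1..n}. \<exists>a b. soliton n X a b \<and> i \<in> set (balls X a b))"

definition rightmost_run :: "nat \<Rightarrow> (int \<Rightarrow> nat) \<Rightarrow> nat list \<Rightarrow> bool" where
  "rightmost_run n X R \<longleftrightarrow>
     (\<exists>a b. increasing_run n X a b \<and> R = balls X a b \<and>
            (\<forall>a' b'. increasing_run n X a' b' \<longrightarrow> b' \<le> b))"

definition rightmost_soliton :: "nat \<Rightarrow> (int \<Rightarrow> nat) \<Rightarrow> nat list \<Rightarrow> bool" where
  "rightmost_soliton n X S \<longleftrightarrow>
     (\<exists>a b. soliton n X a b \<and> S = balls X a b \<and>
            (\<forall>a' b'. soliton n X a' b' \<longrightarrow> b' \<le> b))"

definition bbs_rightmost_soliton :: "nat \<Rightarrow> (int \<Rightarrow> nat) \<Rightarrow> nat list \<Rightarrow> bool" where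
  "bbs_rightmost_soliton n X S \<longleftrightarrow>
     (\<exists>t. steady_state n ((BB n ^^ t) X) \<and> rightmost_soliton n ((BB n ^^ t) X) S)"

text \<open>
  Robinson--Schensted row insertion. In an increasing row, the first entry exceeding \<open>x\<close> is the
  smallest such entry; it is bumped and returned as the second component.
\<close>

fun row_insert :: "nat \<Rightarrow> nat list \<Rightarrow> nat list \<times> nat option" where
  "row_insert x [] = ([x], None)"
| "row_insert x (y # ys) =
     (if x < y then (x # ys, Some y)
      else (let (zs, b) = row_insert x ys in (y # zs, b)))"

fun tableau_insert :: "nat \<Rightarrow> nat list list \<Rightarrow> nat list list" where
  "tableau_insert x [] = [[x]]"
| "tableau_insert x (r # rs) =
     (case row_insert x r of
        (r', None) \<Rightarrow> r' # rs
      | (r', Some y) \<Rightarrow> r' # tableau_insert y rs)"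

definition insertion_tableau :: "nat list \<Rightarrow> nat list list" where
  "insertion_tableau xs = fold tableau_insert xs []"

definition one_line :: "nat \<Rightarrow> (nat \<Rightarrow> nat) \<Rightarrow> nat list" where
  "one_line n w = map w [1..<Suc n]"

end

theory Submission
  imports Defs "HOL-Library.Multiset"
begin

text \<open>
  One move can be carried out by a single sweep from left to right with a \<^emph>\<open>carrier\<close>, an increasing
  list of balls that starts out empty. At a ball, the carrier row-inserts it and puts down
  the bumped ball, or leaves the box empty if nothing was bumped; at an empty box it puts down its
  smallest ball. A ball rides in the carrier exactly from the box it leaves until the first box that
  is free when its turn comes, which is why this agrees with the successive jumps (\<open>BB_move\<close>). A word
  without empty boxes therefore leaves the first row of its insertion tableau in the carrier, and
  that row is then unloaded, in increasing order, into the boxes following the word. So for a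
  permutation the first row \<open>R\<close> of the tableau is the rightmost run after one move.

  Why does it stay? To an increasing list \<open>C\<close> associate the function counting its entries \<open>\<le> v\<close>.
  Row insertion becomes one step of the dynamic program for longest increasing subsequences
  (\<open>count_upto_load\<close>), and the final carriers of successive sweeps can only grow in this order, because
  a sweep ends by reading the previous final carrier. They are bounded by the maximal length of an
  increasing subsequence with values \<open>\<le> v\<close> in the word of balls. That bound does not change in time:
  a sweep changes the word \<open>C x\<close>, the carrier followed by the next letter, by Knuth relations
  (\<open>lis_move\<close>). For a permutation the first final carrier already attains the bound
  (\<open>final_carrier_permutation_stable\<close>), and for an arbitrary word the final carrier is eventually
  constant (\<open>final_carrier_stabilises\<close>).

  Steady state follows by induction on the number of balls. Once the last run \<open>S\<close> is constant, reading
  \<open>S\<close> must push the whole previous content of the carrier out, one ball for each entry of \<open>S\<close>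
  (\<open>stable_last_run_displaces_carrier\<close>): these balls land exactly where they would land if the boxes of
  \<open>S\<close> were empty. The part to the left of \<open>S\<close> thus evolves as if \<open>S\<close> were not there, and
  the induction hypothesis applies to it (\<open>eventually_constant_runs\<close>).

  Finally, if some configuration is steady, its last ball lies in its rightmost soliton. That ball is
  read last, so it lies in the final carrier \<open>R\<close>, which is a run one move later; two runs
  sharing a ball coincide, so the soliton is \<open>R\<close>. This settles uniqueness, also when the initial
  configuration itself is already steady.
\<close>

section \<open>The carrier\<close>

definition load :: "nat \<Rightarrow> nat \<Rightarrow> nat list \<Rightarrow> nat list" where
  "load n x C = (if x \<le> n then fst (row_insert x C) else tl C)"

definition unload :: "nat \<Rightarrow> nat \<Rightarrow> nat list \<Rightarrow> nat" where
  "unload n x C =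
     (if x \<le> n then (case snd (row_insert x C) of None \<Rightarrow> Suc n | Some y \<Rightarrow> y)
      else if C = [] then Suc n else hd C)"

primrec carrier :: "nat \<Rightarrow> nat list \<Rightarrow> nat list \<Rightarrow> nat list" where
  "carrier n [] C = C"
| "carrier n (x # xs) C = carrier n xs (load n x C)"

primrec emitted :: "nat \<Rightarrow> nat list \<Rightarrow> nat list \<Rightarrow> nat list" where
  "emitted n [] C = []"
| "emitted n (x # xs) C = unload n x C # emitted n xs (load n x C)"

text \<open>
  After the word there are only empty boxes, at which the carrier is unloaded in order.
\<close>

definition move :: "nat \<Rightarrow> nat list \<Rightarrow> nat list" where
  "move n xs = emitted n xs [] @ carrier n xs []"

definition ball_word :: "nat \<Rightarrow> nat list \<Rightarrow> nat list" where
  "ball_word n xs = filter (\<lambda>x. x \<le> n) xs"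

text \<open>
  The invariant of a sweep, for a carrier \<open>C\<close> about to read \<open>xs\<close>. Distinctness is required jointly: a ball
  must not be in the carrier and in a box still to be read. The value \<open>Suc n\<close> stands for an empty box.
\<close>

definition admissible :: "nat \<Rightarrow> nat list \<Rightarrow> nat list \<Rightarrow> bool" where
  "admissible n C xs \<longleftrightarrow>
     sorted_wrt (<) C \<and> set C \<subseteq> {1..n} \<and> set xs \<subseteq> {1..Suc n} \<and> distinct (C @ ball_word n xs)"

lemma ball_word_simps [simp]:
  "ball_word n [] = []"
  "ball_word n (x # xs) = (if x \<le> n then x # ball_word n xs else ball_word n xs)"
  "ball_word n (xs @ ys) = ball_word n xs @ ball_word n ys"
  "ball_word n (replicate k (Suc n)) = []"
  by (simp_all add: ball_word_def)

lemma set_ball_word [simp]: "set (ball_word n xs) = set xs \<inter> {..n}"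
  by (auto simp: ball_word_def)

lemma ball_word_id: "set xs \<subseteq> {1..n} \<Longrightarrow> ball_word n xs = xs"
  by (auto simp: ball_word_def filter_id_conv)

lemma carrier_append: "carrier n (xs @ ys) C = carrier n ys (carrier n xs C)"
  by (induction xs arbitrary: C) simp_all

lemma emitted_append: "emitted n (xs @ ys) C = emitted n xs C @ emitted n ys (carrier n xs C)"
  by (induction xs arbitrary: C) simp_all

lemma length_emitted [simp]: "length (emitted n xs C) = length xs"
  by (induction xs arbitrary: C) simp_all

lemma row_insert_append_greater:
  "\<forall>a\<in>set A. a < x \<Longrightarrow> row_insert x (A @ B) = (A @ fst (row_insert x B), snd (row_insert x B))"
  by (induction A) (auto simp: split_beta)

lemma carrier_step_cases:
  assumes "admissible n C (x # xs)"
  obtains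
    (extend) "x \<le> n" "\<forall>c\<in>set C. c < x" "load n x C = C @ [x]" "unload n x C = Suc n"
  | (bump) A y B where "x \<le> n" "C = A @ y # B" "\<forall>a\<in>set A. a < x" "x < y"
      "load n x C = A @ x # B" "unload n x C = y"
  | (idle) "x = Suc n" "C = []" "load n x C = []" "unload n x C = Suc n"
  | (release) c C' where "x = Suc n" "C = c # C'" "load n x C = C'" "unload n x C = c"
proof (cases "x \<le> n")
  case True
  with assms have "x \<notin> set C" by (auto simp: admissible_def)
  define A where "A = takeWhile (\<lambda>a. a < x) C"
  define B where "B = dropWhile (\<lambda>a. a < x) C"
  have C: "C = A @ B" by (simp add: A_def B_def)
  have A: "\<forall>a\<in>set A. a < x" by (auto simp: A_def dest: set_takeWhileD)
  show ?thesis
  proof (cases B)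
    case Nil
    with C A True show ?thesis
      using row_insert_append_greater[OF A, of "[]"]
      by (intro extend) (auto simp: load_def unload_def)
  next
    case (Cons y B')
    then have "\<not> y < x"
      unfolding B_def by (metis dropWhile_eq_Cons_conv)
    moreover have "y \<noteq> x" using \<open>x \<notin> set C\<close> C Cons by auto
    ultimately have "x < y" by simp
    then show ?thesis
      using row_insert_append_greater[OF A, of B] C Cons A True
      by (intro bump[of A y B']) (auto simp: load_def unload_def)
  qed
next
  case False
  then have "x = Suc n" using assms by (auto simp: admissible_def)
  then show ?thesis
    using idle release by (cases C) (auto simp: load_def unload_def)
qed

lemma admissible_load:
  assumes "admissible n C (x # xs)"
  shows "admissible n (load n x C) xs"
  using assms
proof (cases rule: carrier_step_cases)
  case (bump A y B)
  then show ?thesis using assms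
    by (auto simp: admissible_def sorted_wrt_append)
qed (use assms in \<open>auto simp: admissible_def sorted_wrt_append\<close>)

text \<open>
  The last part is greediness: a carried ball \<open>c\<close> for which the box is free at its turn (that is,
  the box is empty or its ball \<open>x < c\<close> has already left) can be skipped only in favour of a smaller one.
\<close>

lemma unload_properties:
  assumes "admissible n C (x # xs)"
  shows "unload n x C \<in> {1..Suc n}"
    and "x \<le> n \<Longrightarrow> x < unload n x C"
    and "unload n x C \<le> n \<Longrightarrow> unload n x C \<in> set C"
    and "c \<in> set C \<Longrightarrow> x < c \<or> n < x \<Longrightarrow> unload n x C \<le> c"
  using assms
  by (cases rule: carrier_step_cases; use assms in \<open>fastforce simp: admissible_def sorted_wrt_append\<close>)+

lemma admissible_carrier: "admissible n C (xs @ ys) \<Longrightarrow> admissible n (carrier n xs C) ys"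
  by (induction xs arbitrary: C) (auto dest: admissible_load)

lemma admissible_prefix: "admissible n C (xs @ ys) \<Longrightarrow> admissible n C xs"
  by (auto simp: admissible_def)

lemma carrier_conserves_balls:
  assumes "admissible n C xs"
  shows "mset (ball_word n (emitted n xs C)) + mset (carrier n xs C) = mset C + mset (ball_word n xs)"
  using assms
proof (induction xs arbitrary: C)
  case (Cons x xs)
  note IH = Cons.IH[OF admissible_load[OF Cons.prems]]
  from Cons.prems show ?case
  proof (cases rule: carrier_step_cases)
    case (bump A y B)
    then have "y \<le> n" using Cons.prems by (auto simp: admissible_def)
    then show ?thesis using bump IH by (simp add: ac_simps)
  next
    case (release c C')
    then have "c \<le> n" using Cons.prems by (auto simp: admissible_def)
    then show ?thesis using release IH by simp
  qed (use IH in auto)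
qed simp

lemma set_emitted: "admissible n C xs \<Longrightarrow> set (emitted n xs C) \<subseteq> {1..Suc n}"
proof (induction xs arbitrary: C)
  case (Cons x xs)
  then show ?case
    using unload_properties(1)[OF Cons.prems] Cons.IH[OF admissible_load[OF Cons.prems]] by auto
qed simp

lemma ball_word_move:
  assumes "admissible n [] xs"
  shows "mset (ball_word n (move n xs)) = mset (ball_word n xs)"
proof -
  have "set (carrier n xs []) \<subseteq> {1..n}"
    using admissible_carrier[of n "[]" xs "[]"] assms by (simp add: admissible_def)
  then show ?thesis
    using carrier_conserves_balls[OF assms] by (simp add: move_def ball_word_id)
qed

lemma admissible_move:
  assumes "admissible n [] xs"
  shows "admissible n [] (move n xs)"
proof -
  have "distinct (ball_word n (move n xs))"
    using ball_word_move[OF assms] assms mset_eq_imp_distinct_iff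
    by (fastforce simp: admissible_def)
  moreover have "set (carrier n xs []) \<subseteq> {1..n}"
    using admissible_carrier[of n "[]" xs "[]"] assms by (simp add: admissible_def)
  ultimately show ?thesis
    using set_emitted[OF assms] by (fastforce simp: admissible_def move_def)
qed

lemma admissible_move_iterate: "admissible n [] xs \<Longrightarrow> admissible n [] ((move n ^^ t) xs)"
  by (induction t) (simp_all add: admissible_move)

lemma ball_word_move_iterate:
  "admissible n [] xs \<Longrightarrow> mset (ball_word n ((move n ^^ t) xs)) = mset (ball_word n xs)"
  by (induction t) (simp_all add: ball_word_move admissible_move_iterate)

lemma carrier_of_empty_boxes: "carrier n (replicate k (Suc n)) C = drop k C"
  by (induction k arbitrary: C) (simp_all add: load_def drop_Suc)

lemma emitted_of_empty_boxes:
  "emitted n (replicate k (Suc n)) C = take k C @ replicate (k - length C) (Suc n)"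
proof (induction k arbitrary: C)
  case (Suc k)
  then show ?case by (cases C) (simp_all add: load_def unload_def)
qed simp

text \<open>
  Appending just enough empty boxes lets the sweep itself do the unloading.
\<close>

lemma move_eq_emitted:
  "move n xs = emitted n (xs @ replicate (length (carrier n xs [])) (Suc n)) []"
  by (simp add: move_def emitted_append emitted_of_empty_boxes)

lemma move_trailing_empty_boxes:
  "\<exists>j. move n (xs @ replicate k (Suc n)) = move n xs @ replicate j (Suc n)"
  by (rule exI[of _ "k - length (carrier n xs [])"])
     (cases "k \<le> length (carrier n xs [])";
      simp add: move_def carrier_append emitted_append carrier_of_empty_boxes emitted_of_empty_boxes)

lemma move_iterate_trailing_empty_boxes:
  "\<exists>j. (move n ^^ t) (xs @ replicate k (Suc n)) = (move n ^^ t) xs @ replicate j (Suc n)"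
proof (induction t)
  case (Suc t)
  then show ?case using move_trailing_empty_boxes by fastforce
qed auto

section \<open>Longest increasing subsequences\<close>

text \<open>
  If \<open>f v\<close> is the maximal length of an increasing subsequence with values \<open>\<le> v\<close> of a word with distinct
  letters, then \<open>lis_step x f\<close> is that function for the word followed by a new letter \<open>x\<close>.
\<close>

definition lis_step :: "nat \<Rightarrow> (nat \<Rightarrow> nat) \<Rightarrow> nat \<Rightarrow> nat" where
  "lis_step x f v = (if v < x then f v else max (f v) (Suc (f x)))"

definition lis :: "nat \<Rightarrow> nat list \<Rightarrow> nat \<Rightarrow> nat" where
  "lis n xs = fold lis_step (ball_word n xs) (\<lambda>_. 0)"

definition count_upto :: "nat list \<Rightarrow> nat \<Rightarrow> nat" where
  "count_upto C v = length (filter (\<lambda>c. c \<le> v) C)"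

lemma lis_step_monotone: "f \<le> g \<Longrightarrow> lis_step x f \<le> lis_step x g"
  by (auto simp: lis_step_def le_fun_def simp del: max.bounded_iff intro!: max.mono)

lemma fold_lis_step_monotone: "f \<le> g \<Longrightarrow> fold lis_step xs f \<le> fold lis_step xs g"
  by (induction xs arbitrary: f g) (simp_all add: lis_step_monotone)

lemma mono_lis_step:
  assumes "mono f" shows "mono (lis_step x f)"
proof (rule monoI)
  fix u v :: nat assume "u \<le> v"
  with assms have "f u \<le> f v" by (rule monoD)
  then show "lis_step x f u \<le> lis_step x f v"
    using \<open>u \<le> v\<close> by (auto simp: lis_step_def)
qed

lemma mono_fold_lis_step: "mono f \<Longrightarrow> mono (fold lis_step xs f)"
  by (induction xs arbitrary: f) (simp_all add: mono_lis_step)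

text \<open>
  The two Knuth relations \<open>y x z = y z x\<close> and \<open>x z y = z x y\<close> for \<open>x < y < z\<close>, acting on monotone
  functions.
\<close>

lemma lis_step_knuth1:
  assumes "mono f" "x < y" "y < z"
  shows "lis_step z (lis_step x (lis_step y f)) = lis_step x (lis_step z (lis_step y f))"
proof
  fix v
  have "f x \<le> f y" "f y \<le> f z" "f x \<le> f z" "z \<le> v \<Longrightarrow> f z \<le> f v" "y \<le> v \<Longrightarrow> f y \<le> f v"
    "x \<le> v \<Longrightarrow> f x \<le> f v"
    using assms by (auto intro: monoD)
  then show "lis_step z (lis_step x (lis_step y f)) v = lis_step x (lis_step z (lis_step y f)) v"
    using assms(2,3) by (auto simp: lis_step_def)
qed

lemma lis_step_knuth2:
  assumes "mono f" "x < y" "y < z"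
  shows "lis_step y (lis_step z (lis_step x f)) = lis_step y (lis_step x (lis_step z f))"
proof
  fix v
  have "f x \<le> f y" "f y \<le> f z" "f x \<le> f z" "z \<le> v \<Longrightarrow> f z \<le> f v" "y \<le> v \<Longrightarrow> f y \<le> f v"
    "x \<le> v \<Longrightarrow> f x \<le> f v"
    using assms by (auto intro: monoD)
  then show "lis_step y (lis_step z (lis_step x f)) v = lis_step y (lis_step x (lis_step z f)) v"
    using assms(2,3) by (auto simp: lis_step_def)
qed

lemma fold_lis_step_small_letter_left:
  assumes "mono f" "x < y" "sorted_wrt (<) (y # B)"
  shows "fold lis_step (y # B @ [x]) f = fold lis_step (y # x # B) f"
  using assms
proof (induction B arbitrary: f y)
  case (Cons b B)
  have "fold lis_step (y # (b # B) @ [x]) f = fold lis_step (b # B @ [x]) (lis_step y f)"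
    by simp
  also have "\<dots> = fold lis_step (b # x # B) (lis_step y f)"
    using Cons.prems by (intro Cons.IH) (auto simp: mono_lis_step)
  also have "\<dots> = fold lis_step (y # x # b # B) f"
    using lis_step_knuth1[of f x y b] Cons.prems by simp
  finally show ?case .
qed simp

lemma fold_lis_step_large_letter_left:
  assumes "mono f" "x < y" "sorted_wrt (<) (A @ [x])"
  shows "fold lis_step (A @ [y, x]) f = fold lis_step (y # A @ [x]) f"
  using assms
proof (induction A arbitrary: x rule: rev_induct)
  case (snoc a A)
  have "fold lis_step ((A @ [a]) @ [y, x]) f = fold lis_step [a, y, x] (fold lis_step A f)"
    by simp
  also have "\<dots> = fold lis_step [y, a, x] (fold lis_step A f)"
    using lis_step_knuth2[of "fold lis_step A f" a x y] snoc.prems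
    by (simp add: mono_fold_lis_step sorted_wrt_append)
  also have "\<dots> = lis_step x (fold lis_step (A @ [y, a]) f)"
    by simp
  also have "\<dots> = lis_step x (fold lis_step (y # A @ [a]) f)"
    using snoc.prems by (subst snoc.IH) (auto simp: sorted_wrt_append)
  finally show ?case by simp
qed simp

text \<open>
  Row insertion as a plactic identity: with \<open>y\<close> the first entry exceeding \<open>x\<close>, the letter \<open>x\<close> is moved
  left through \<open>B\<close> by the first relation, and then \<open>y\<close> is moved left through \<open>A\<close> by the second.
\<close>

lemma fold_lis_step_bump:
  assumes "mono f" "sorted_wrt (<) (A @ y # B)" "\<forall>a\<in>set A. a < x" "x < y"
  shows "fold lis_step (A @ y # B @ [x]) f = fold lis_step (y # A @ x # B) f"
proof -
  have "fold lis_step (A @ y # B @ [x]) f = fold lis_step (y # B @ [x]) (fold lis_step A f)"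
    by simp
  also have "\<dots> = fold lis_step B (fold lis_step (A @ [y, x]) f)"
    using assms fold_lis_step_small_letter_left[of "fold lis_step A f" x y B]
    by (simp add: mono_fold_lis_step sorted_wrt_append)
  also have "\<dots> = fold lis_step B (fold lis_step (y # A @ [x]) f)"
    using assms by (subst fold_lis_step_large_letter_left) (auto simp: sorted_wrt_append)
  finally show ?thesis by simp
qed

text \<open>
  A bump is a sequence of Knuth relations. In all other steps the word formed by the emitted balls, the carrier
  and the balls still to be read does not change at all: a maximal ball joins the carrier at its right
  end, and an empty box detaches its left end.
\<close>

lemma lis_carrier_invariant:
  assumes "admissible n C xs" "mono f"
  shows "fold lis_step (ball_word n (emitted n xs C) @ carrier n xs C) f
       = fold lis_step (C @ ball_word n xs) f"
  using assms
proof (induction xs arbitrary: C f)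
  case (Cons x xs)
  note IH = Cons.IH[OF admissible_load[OF Cons.prems(1)]]
  from Cons.prems(1) show ?case
  proof (cases rule: carrier_step_cases)
    case (bump A y B)
    then have "y \<le> n" and "sorted_wrt (<) (A @ y # B)"
      using Cons.prems by (auto simp: admissible_def)
    then show ?thesis
      using bump IH[of "lis_step y f"] fold_lis_step_bump[of f A y B x] Cons.prems(2)
      by (simp add: mono_lis_step)
  next
    case (release c C')
    then have "c \<le> n" using Cons.prems by (auto simp: admissible_def)
    then show ?thesis using release IH[of "lis_step c f"] Cons.prems(2) by (simp add: mono_lis_step)
  qed (use IH[of f] Cons.prems(2) in auto)
qed simp

lemma lis_move:
  assumes "admissible n [] xs"
  shows "lis n (move n xs) = lis n xs"
proof -
  have "set (carrier n xs []) \<subseteq> {1..n}"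
    using admissible_carrier[of n "[]" xs "[]"] assms by (simp add: admissible_def)
  then show ?thesis
    using lis_carrier_invariant[OF assms, of "\<lambda>_. 0"]
    by (simp add: lis_def move_def ball_word_id monoI)
qed

lemma lis_move_iterate: "admissible n [] xs \<Longrightarrow> lis n ((move n ^^ t) xs) = lis n xs"
  by (induction t) (simp_all add: lis_move admissible_move_iterate)

text \<open>
  No entry of \<open>C\<close> lies between \<open>x\<close> and the bumped entry \<open>y\<close>. Hence the count grows by one exactly
  on \<open>x \<le> v < y\<close>, and from \<open>y\<close> on it already exceeds its value at \<open>x\<close>.
\<close>

lemma count_upto_load:
  assumes "admissible n C (x # xs)" "x \<le> n"
  shows "count_upto (load n x C) = lis_step x (count_upto C)"
  using assms(1)
proof (cases rule: carrier_step_cases)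
  case extend
  then have "\<forall>c\<in>set C. x \<le> v \<longrightarrow> c \<le> v" for v by auto
  moreover have "\<forall>c\<in>set C. c \<le> x" using extend by auto
  ultimately show ?thesis using extend
    by (auto simp: count_upto_def lis_step_def fun_eq_iff)
next
  case (bump A y B)
  have B: "\<forall>b\<in>set B. y < b"
    using assms(1) bump by (auto simp: admissible_def sorted_wrt_append)
  show ?thesis
  proof
    fix v
    have low: "v < y \<Longrightarrow> filter (\<lambda>c. c \<le> v) B = []" for v
      using B by (force simp: filter_empty_conv)
    have all: "x \<le> v \<Longrightarrow> filter (\<lambda>c. c \<le> v) A = A" for v
      using bump by (auto simp: filter_id_conv)
    show "count_upto (load n x C) v = lis_step x (count_upto C) v"
      using bump low[of v] low[of x] all[of v] all[of x]
      by (auto simp: count_upto_def lis_step_def not_le)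
  qed
qed (use assms in auto)

lemma count_upto_carrier:
  assumes "admissible n C xs" "set xs \<subseteq> {1..n}"
  shows "count_upto (carrier n xs C) = fold lis_step xs (count_upto C)"
  using assms
  by (induction xs arbitrary: C) (auto simp: count_upto_load admissible_load)

lemma count_upto_inject:
  assumes "sorted_wrt (<) C" "sorted_wrt (<) D" "0 \<notin> set C" "0 \<notin> set D"
    and "count_upto C = count_upto D"
  shows "C = D"
proof -
  have step: "count_upto E (Suc v) = count_upto E v + (if Suc v \<in> set E then 1 else 0)"
    if "sorted_wrt (<) E" for E v
    using that by (induction E) (auto simp: count_upto_def le_Suc_eq)
  have "v \<in> set C \<longleftrightarrow> v \<in> set D" for v
    using assms step[of C "v - 1"] step[of D "v - 1"]
    by (cases v) (auto split: if_splits)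
  then show ?thesis
    using assms strict_sorted_equal by blast
qed

section \<open>Monotonicity and stability of the final carrier\<close>

lemma read_increasing_word:
  assumes "sorted_wrt (<) (C @ S)" "set S \<subseteq> {1..n}"
  shows "carrier n S C = C @ S" "emitted n S C = replicate (length S) (Suc n)"
proof -
  have "carrier n S C = C @ S \<and> emitted n S C = replicate (length S) (Suc n)"
    using assms
  proof (induction S arbitrary: C)
    case (Cons x S)
    then have "load n x C = C @ [x]" "unload n x C = Suc n"
      using row_insert_append_greater[of C x "[]"]
      by (auto simp: load_def unload_def sorted_wrt_append)
    then show ?case using Cons by simp
  qed simp
  then show "carrier n S C = C @ S" "emitted n S C = replicate (length S) (Suc n)" by simp_all
qed

lemma count_upto_Nil: "count_upto [] = (\<lambda>_. 0)"
  by (simp add: count_upto_def fun_eq_iff)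

lemma count_upto_le_lis_append:
  assumes "admissible n [] S" "set S \<subseteq> {1..n}" "sorted_wrt (<) S"
  shows "count_upto S \<le> fold lis_step S f"
proof -
  have "carrier n S [] = S" using read_increasing_word(1)[of "[]" S n] assms by simp
  then have "count_upto S = fold lis_step S (\<lambda>_. 0)"
    using count_upto_carrier[OF assms(1,2)] by (simp add: count_upto_Nil)
  also have "\<dots> \<le> fold lis_step S f" by (rule fold_lis_step_monotone) (simp add: le_fun_def)
  finally show ?thesis .
qed

lemma final_carrier_properties:
  assumes "admissible n [] xs"
  shows "sorted_wrt (<) (carrier n xs [])" "set (carrier n xs []) \<subseteq> {1..n}"
    "admissible n [] (carrier n xs [])"
proof -
  have *: "admissible n (carrier n xs []) []"
    using admissible_carrier[of n "[]" xs "[]"] assms by simp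
  then show "sorted_wrt (<) (carrier n xs [])" "set (carrier n xs []) \<subseteq> {1..n}"
    by (simp_all add: admissible_def)
  with * show "admissible n [] (carrier n xs [])"
    by (auto simp: admissible_def ball_word_id)
qed

text \<open>
  The final carrier is itself an increasing subsequence of the moved word, which has the same
  longest increasing subsequences as the original one.
\<close>

lemma count_upto_le_lis:
  assumes "admissible n [] xs"
  shows "count_upto (carrier n xs []) \<le> lis n xs"
proof -
  note S = final_carrier_properties[OF assms]
  have "lis n xs = lis n (move n xs)" by (simp add: lis_move assms)
  also have "\<dots> = fold lis_step (carrier n xs []) (lis n (emitted n xs []))"
    using S by (simp add: lis_def move_def ball_word_id)
  finally show ?thesis using count_upto_le_lis_append[OF S(3,2,1)] by simp
qed

text \<open>
  The next sweep ends by reading the previous final carrier, and inserting it into any carrier gives at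
  least as much as inserting it into the empty one.
\<close>

lemma count_upto_final_carrier_increases:
  assumes "admissible n [] xs"
  shows "count_upto (carrier n xs []) \<le> count_upto (carrier n (move n xs) [])"
proof -
  note S = final_carrier_properties[OF assms]
  have "admissible n (carrier n (emitted n xs []) []) (carrier n xs [])"
    using admissible_carrier admissible_move[OF assms] by (simp add: move_def)
  then show ?thesis
    using count_upto_carrier[OF _ S(2)] count_upto_le_lis_append[OF S(3,2,1)]
    by (simp add: move_def carrier_append)
qed

lemma final_carrier_stabilises:
  assumes "admissible n [] xs"
  shows "\<exists>T S. \<forall>t\<ge>T. carrier n ((move n ^^ t) xs) [] = S"
proof -
  define S where "S t = carrier n ((move n ^^ t) xs) []" for t
  \<comment> \<open>A bounded integer potential; it is maximal from some time on, and then no single count can grow.\<close>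
  define M where "M t = (\<Sum>v\<le>n. count_upto (S t) v)" for t
  note adm = admissible_move_iterate[OF assms]
  have incr: "count_upto (S t) \<le> count_upto (S (Suc t))" for t
    using count_upto_final_carrier_increases[OF adm] by (simp add: S_def)
  then have incr': "s \<le> t \<Longrightarrow> count_upto (S s) \<le> count_upto (S t)" for s t
    by (rule lift_Suc_mono_le)
  have "M t \<le> (\<Sum>v\<le>n. lis n xs v)" for t
    using count_upto_le_lis[OF adm] lis_move_iterate[OF assms]
    unfolding M_def S_def by (intro sum_mono) (metis le_funD)
  then have bounded: "\<forall>k. k \<in> range M \<longrightarrow> k \<le> (\<Sum>v\<le>n. lis n xs v)"
    by auto
  obtain T where T: "\<And>t. M t \<le> M T"
    using Greatest_le_nat[of "\<lambda>k. k \<in> range M", OF _ bounded[rule_format]]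
      GreatestI_nat[of "\<lambda>k. k \<in> range M", OF _ bounded[rule_format]]
    by (metis rangeE rangeI)
  have "S t = S T" if "T \<le> t" for t
  proof -
    have le: "count_upto (S T) v \<le> count_upto (S t) v" for v
      using incr'[OF that] by (simp add: le_fun_def)
    have "count_upto (S T) v = count_upto (S t) v" if "v \<le> n" for v
    proof (rule ccontr)
      assume "count_upto (S T) v \<noteq> count_upto (S t) v"
      then have "M T < M t"
        unfolding M_def using le that
        by (intro sum_strict_mono_ex1) (auto intro!: bexI[of _ v] simp: order.strict_iff_order)
      then show False using T[of t] by simp
    qed
    moreover have "count_upto (S r) v = count_upto (S r) n" if "n \<le> v" for r v
      using final_carrier_properties(2)[OF adm[of r]] that
      unfolding count_upto_def S_def by (intro arg_cong[of _ _ length] filter_cong) auto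
    ultimately have "count_upto (S t) = count_upto (S T)"
      by (metis ext nat_le_linear order_refl)
    then show ?thesis
      using final_carrier_properties[OF adm] unfolding S_def
      by (intro count_upto_inject) force+
  qed
  then show ?thesis unfolding S_def by blast
qed

text \<open>
  Without empty boxes nothing is unloaded before the end, so the first final carrier attains the upper
  bound that holds for all later ones.
\<close>

lemma final_carrier_permutation_stable:
  assumes "admissible n [] xs" "set xs \<subseteq> {1..n}"
  shows "carrier n ((move n ^^ t) xs) [] = carrier n xs []"
proof -
  define S where "S t = carrier n ((move n ^^ t) xs) []" for t
  note adm = admissible_move_iterate[OF assms(1)]
  have "count_upto (S 0) \<le> count_upto (S t)"
    using count_upto_final_carrier_increases[OF adm]
    by (induction t) (auto simp: S_def intro: order_trans)
  moreover have "count_upto (S t) \<le> lis n xs"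
    using count_upto_le_lis[OF adm] lis_move_iterate[OF assms(1)] by (simp add: S_def)
  moreover have "count_upto (S 0) = lis n xs"
    using count_upto_carrier[OF assms] assms(2)
    by (simp add: S_def lis_def ball_word_id count_upto_Nil)
  ultimately have "count_upto (S t) = count_upto (S 0)" by simp
  then show ?thesis
    using final_carrier_properties[OF adm] final_carrier_properties[OF assms(1)] unfolding S_def
    by (intro count_upto_inject) (force simp: S_def)+
qed

section \<open>Decoupling of a stable last run\<close>

lemma carrier_keeps_small_entry:
  assumes "admissible n C xs" "c \<in> set C" "\<forall>x\<in>set xs. c < x \<and> x \<le> n"
  shows "c \<in> set (carrier n xs C)"
  using assms
proof (induction xs arbitrary: C)
  case (Cons x xs)
  have "c \<in> set (load n x C)"
    using Cons.prems(1) by (cases rule: carrier_step_cases) (use Cons.prems in auto)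
  then show ?case using Cons admissible_load by simp
qed simp

lemma read_above_smaller_entry:
  assumes "\<forall>x\<in>set xs. c < x \<and> x \<le> n"
  shows "carrier n xs (c # C) = c # carrier n xs C" "emitted n xs (c # C) = emitted n xs C"
proof -
  have "carrier n xs (c # C) = c # carrier n xs C \<and> emitted n xs (c # C) = emitted n xs C"
    using assms
    by (induction xs arbitrary: C) (auto simp: load_def unload_def split_beta)
  then show "carrier n xs (c # C) = c # carrier n xs C" "emitted n xs (c # C) = emitted n xs C"
    by simp_all
qed

text \<open>
  If no carried ball survives the reading of \<open>S\<close>, then each \<open>x\<close> in \<open>S\<close> must bump the smallest ball \<open>c\<close> still
  carried over from before: otherwise \<open>c < x\<close>, and neither \<open>x\<close> nor any later letter could bump \<open>c\<close>.
\<close>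

lemma stable_last_run_displaces_carrier:
  assumes "admissible n C S" "sorted_wrt (<) S" "set S \<subseteq> {1..n}"
    and "set (carrier n S C) \<inter> set C = {}"
  shows "emitted n S C = C @ replicate (length S - length C) (Suc n) \<and> length C \<le> length S"
  using assms
proof (induction S arbitrary: C)
  case (Cons x S)
  show ?case
  proof (cases C)
    case Nil
    then show ?thesis using read_increasing_word[of "[]" "x # S" n] Cons.prems by simp
  next
    case (Cons c C')
    have "x \<noteq> c" using Cons.prems Cons by (auto simp: admissible_def)
    moreover have "\<not> c < x"
    proof
      assume "c < x"
      then have "c \<in> set (carrier n (x # S) C)"
        using Cons.prems Cons by (intro carrier_keeps_small_entry) auto
      then show False using Cons.prems(4) Cons by auto
    qed
    ultimately have "x < c" by simp
    then have step: "load n x C = x # C'" "unload n x C = c"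
      using Cons Cons.prems(3) by (auto simp: load_def unload_def)
    have rest: "carrier n S (x # C') = x # carrier n S C'" "emitted n S (x # C') = emitted n S C'"
      using Cons.prems by (auto intro!: read_above_smaller_entry)
    have "admissible n C' S"
      using Cons.prems(1) Cons by (auto simp: admissible_def split: if_splits)
    moreover have "set (carrier n S C') \<inter> set C' = {}"
      using Cons.prems(4) Cons step rest by auto
    ultimately show ?thesis
      using Cons.IH[of C'] Cons.prems Cons step rest by simp
  qed
qed simp

text \<open>
  At a final ball the carrier loads that ball and emits something larger. This separates the unloaded
  carrier from what precedes it, so that the final carrier is a maximal increasing run.
\<close>

lemma last_emitted_greater:
  assumes "admissible n C xs" "xs \<noteq> []" "last xs \<le> n"
  shows "hd (carrier n xs C) \<le> last xs" "last xs < last (emitted n xs C)"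
    "last xs \<in> set (carrier n xs C)"
proof -
  obtain ys x where xs: "xs = ys @ [x]" using assms(2) by (cases xs rule: rev_cases) auto
  define D where "D = carrier n ys C"
  have adm: "admissible n D [x]"
    using admissible_carrier assms(1) by (simp add: D_def xs)
  have x: "x \<le> n" using assms(3) xs by simp
  have "x < unload n x D" using unload_properties(2)[OF adm x] .
  then show "last xs < last (emitted n xs C)"
    by (simp add: xs emitted_append D_def)
  have "sorted_wrt (<) (load n x D)"
    using admissible_load[OF adm] by (simp add: admissible_def)
  moreover have "x \<in> set (load n x D)"
    using adm by (cases rule: carrier_step_cases) (use x in auto)
  ultimately show "hd (carrier n xs C) \<le> last xs" "last xs \<in> set (carrier n xs C)"
    by (cases "load n x D"; force simp: xs carrier_append D_def)+
qed

section \<open>Reaching steady state\<close>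

text \<open>
  The decomposition of a word into its maximal increasing runs, built from left to right. A run ends at an
  empty box, at a descent or at the end of the word; since \<open>Suc n\<close> exceeds all balls, the condition
  \<open>hd r < last xs\<close> covers both a preceding empty box and a descent.
\<close>

inductive runs_of :: "nat \<Rightarrow> nat list \<Rightarrow> nat list list \<Rightarrow> bool" for n where
  empty: "runs_of n [] []"
| gap: "runs_of n xs rs \<Longrightarrow> runs_of n (xs @ [Suc n]) rs"
| run: "runs_of n xs rs \<Longrightarrow> r \<noteq> [] \<Longrightarrow> sorted_wrt (<) r \<Longrightarrow> set r \<subseteq> {1..n} \<Longrightarrow>
    xs = [] \<or> hd r < last xs \<Longrightarrow> runs_of n (xs @ r) (rs @ [r])"

lemma runs_of_trailing_empty_boxes:
  "runs_of n xs rs \<Longrightarrow> runs_of n (xs @ replicate k (Suc n)) rs"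
proof (induction k)
  case (Suc k)
  then show ?case
    using runs_of.gap[of n "xs @ replicate k (Suc n)" rs]
    by (simp add: replicate_append_same flip: replicate_Suc)
qed simp

lemma runs_of_balls: "runs_of n xs rs \<Longrightarrow> set (ball_word n xs) \<subseteq> (\<Union>r\<in>set rs. set r)"
  by (induction rule: runs_of.induct) auto

lemma runs_of_member:
  assumes "runs_of n xs rs" "r \<in> set rs"
  shows "\<exists>u v. xs = u @ r @ v \<and> r \<noteq> [] \<and> sorted_wrt (<) r \<and> set r \<subseteq> {1..n} \<and>
    (u = [] \<or> hd r < last u) \<and> (v = [] \<or> hd v = Suc n \<or> hd v < last r)"
  using assms
proof (induction rule: runs_of.induct)
  case (gap xs rs)
  then obtain u v where "xs = u @ r @ v" "r \<noteq> []" "sorted_wrt (<) r" "set r \<subseteq> {1..n}"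
    "u = [] \<or> hd r < last u" "v = [] \<or> hd v = Suc n \<or> hd v < last r" by blast
  then show ?case by (intro exI[of _ u] exI[of _ "v @ [Suc n]"]) (auto simp: hd_append)
next
  case (run xs rs r')
  show ?case
  proof (cases "r \<in> set rs")
    case True
    then obtain u v where "xs = u @ r @ v" "r \<noteq> []" "sorted_wrt (<) r" "set r \<subseteq> {1..n}"
      "u = [] \<or> hd r < last u" "v = [] \<or> hd v = Suc n \<or> hd v < last r" using run.IH by blast
    then show ?thesis using run.hyps
      by (intro exI[of _ u] exI[of _ "v @ r'"]) (auto simp: hd_append)
  next
    case False
    then show ?thesis using run by (intro exI[of _ xs] exI[of _ "[]"]) auto
  qed
qed simp

lemma split_trailing_empty_boxes:
  assumes "set xs \<subseteq> {1..Suc n}"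
  obtains ys k where "xs = ys @ replicate k (Suc n)" "ys = [] \<or> last ys \<le> n"
proof -
  have "\<exists>ys k. xs = ys @ replicate k (Suc n) \<and> (ys = [] \<or> last ys \<le> n)"
    using assms
  proof (induction xs rule: rev_induct)
    case (snoc x xs)
    show ?case
    proof (cases "x \<le> n")
      case True
      then show ?thesis by (intro exI[of _ "xs @ [x]"] exI[of _ 0]) auto
    next
      case False
      then have "x = Suc n" using snoc.prems by auto
      obtain ys k where "xs = ys @ replicate k (Suc n)" "ys = [] \<or> last ys \<le> n"
        using snoc by auto
      then show ?thesis
        using \<open>x = Suc n\<close>
        by (intro exI[of _ ys] exI[of _ "Suc k"]) (simp add: replicate_append_same)
    qed
  qed simp
  then show ?thesis using that by blast
qed

lemma move_ends_with_ball:
  assumes "admissible n [] xs" "xs \<noteq> []" "last xs \<le> n"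
  shows "move n xs \<noteq> [] \<and> last (move n xs) \<le> n"
proof -
  have "carrier n xs [] \<noteq> []" using last_emitted_greater(3)[OF assms] by force
  moreover from this have "last (carrier n xs []) \<in> {1..n}"
    using final_carrier_properties(2)[OF assms(1)] last_in_set by blast
  ultimately show ?thesis by (auto simp: move_def)
qed

lemma move_iterate_ends_with_ball:
  assumes "admissible n [] xs" "xs \<noteq> []" "last xs \<le> n"
  shows "(move n ^^ t) xs \<noteq> [] \<and> last ((move n ^^ t) xs) \<le> n"
  by (induction t) (use assms move_ends_with_ball admissible_move_iterate in auto)

text \<open>
  Trailing empty boxes are removed first, so that the last letter is a ball and the final carrier is
  nonempty. Once that carrier is a constant \<open>S\<close>, the part \<open>u s\<close> to its left evolves under \<open>move\<close> by itself,
  up to trailing empty boxes, and it has fewer balls.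
\<close>

lemma eventually_constant_runs:
  assumes "admissible n [] xs"
  shows "\<exists>T rs. \<forall>t\<ge>T. runs_of n ((move n ^^ t) xs) rs"
  using assms
proof (induction "length (ball_word n xs)" arbitrary: xs rule: less_induct)
  case less
  obtain ys k where xs: "xs = ys @ replicate k (Suc n)" and ys: "ys = [] \<or> last ys \<le> n"
    using split_trailing_empty_boxes less.prems unfolding admissible_def by blast
  have adm: "admissible n [] ys" using less.prems xs admissible_prefix by blast
  have "\<exists>T rs. \<forall>t\<ge>T. runs_of n ((move n ^^ t) ys) rs"
  proof (cases "ys = []")
    case True
    have "(move n ^^ t) [] = []" for t by (induction t) (simp_all add: move_def)
    then show ?thesis using True runs_of.empty by auto
  next
    case False
    obtain T S where S: "\<And>t. t \<ge> T \<Longrightarrow> carrier n ((move n ^^ t) ys) [] = S"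
      using final_carrier_stabilises[OF adm] by blast
    define u where "u s = emitted n ((move n ^^ (T + s)) ys) []" for s
    have split: "(move n ^^ (Suc (T + s))) ys = u s @ S" for s
      using S[of "T + s"] by (simp add: u_def move_def)
    have bnd: "hd S < last (u s)" "S \<noteq> []" for s
      using last_emitted_greater[OF admissible_move_iterate[OF adm, of "T + s"]]
        move_iterate_ends_with_ball[OF adm False, of "T + s"] ys False S[of "T + s"]
      by (fastforce simp: u_def)+
    have Sprop: "sorted_wrt (<) S" "set S \<subseteq> {1..n}"
      using final_carrier_properties[OF admissible_move_iterate[OF adm, of T]] S[of T] by auto
    have admu: "admissible n [] (u s @ S)" for s
      using admissible_move_iterate[OF adm, of "Suc (T + s)"] split[of s] by simp
    have decouple: "\<exists>j. u (Suc s) = move n (u s) @ replicate j (Suc n)" for s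
    proof -
      define C where "C = carrier n (u s) []"
      have "carrier n S C = S"
        using S[of "Suc (T + s)"] split[of s] by (simp add: C_def carrier_append)
      moreover have "admissible n C S" using admissible_carrier[OF admu] by (simp add: C_def)
      moreover from this have "set C \<inter> (set S \<inter> {..n}) = {}"
        by (simp add: admissible_def)
      then have "set S \<inter> set C = {}" using Sprop(2) by (auto simp: disjoint_iff)
      ultimately have "emitted n S C = C @ replicate (length S - length C) (Suc n)"
        using stable_last_run_displaces_carrier Sprop by simp
      moreover have "u (Suc s) = emitted n (u s @ S) []"
        using split[of s] by (simp add: u_def)
      ultimately show ?thesis by (auto simp: emitted_append move_def C_def)
    qed
    have iter: "\<exists>j. u s = (move n ^^ s) (u 0) @ replicate j (Suc n)" for s
    proof (induction s)
      case (Suc s)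
      then obtain j where "u s = (move n ^^ s) (u 0) @ replicate j (Suc n)" by blast
      moreover obtain i where "u (Suc s) = move n (u s) @ replicate i (Suc n)"
        using decouple[of s] by blast
      moreover obtain k where "move n ((move n ^^ s) (u 0) @ replicate j (Suc n))
          = (move n ^^ Suc s) (u 0) @ replicate k (Suc n)"
        using move_trailing_empty_boxes[of n "(move n ^^ s) (u 0)" j] by auto
      ultimately have "u (Suc s) = (move n ^^ Suc s) (u 0) @ replicate (k + i) (Suc n)"
        by (simp add: replicate_add)
      then show ?case by blast
    qed simp
    have "mset (ball_word n (u 0 @ S)) = mset (ball_word n ys)"
      using ball_word_move_iterate[OF adm, of "Suc T"] split[of 0] by simp
    then have "length (ball_word n (u 0 @ S)) = length (ball_word n ys)"
      by (rule mset_eq_length)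
    then have "length (ball_word n (u 0)) < length (ball_word n xs)"
      using bnd(2) Sprop xs by (auto simp: ball_word_id neq_Nil_conv)
    moreover have "admissible n [] (u 0)" using admu admissible_prefix by blast
    ultimately obtain T' rs where T': "\<And>t. t \<ge> T' \<Longrightarrow> runs_of n ((move n ^^ t) (u 0)) rs"
      using less.hyps by blast
    have "runs_of n ((move n ^^ t) ys) (rs @ [S])" if "t \<ge> Suc (T + T')" for t
    proof -
      define s where "s = t - Suc T"
      have s: "t = Suc (T + s)" "s \<ge> T'" using that by (simp_all add: s_def)
      have "runs_of n (u s) rs"
        using iter[of s] runs_of_trailing_empty_boxes[OF T'[OF s(2)]] by auto
      then show ?thesis
        using runs_of.run[of n "u s" rs S] bnd Sprop split[of s] s by simp
    qed
    then show ?thesis by blast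
  qed
  then obtain T rs where T: "\<And>t. t \<ge> T \<Longrightarrow> runs_of n ((move n ^^ t) ys) rs" by blast
  have "runs_of n ((move n ^^ t) xs) rs" if "t \<ge> T" for t
    using move_iterate_trailing_empty_boxes[of t n ys k] runs_of_trailing_empty_boxes[OF T[OF that]]
    by (auto simp: xs)
  then show ?case by blast
qed

section \<open>Sweeps and moves of configurations\<close>

definition configuration :: "nat \<Rightarrow> nat list \<Rightarrow> int \<Rightarrow> nat" where
  "configuration n xs p = (if 1 \<le> p \<and> p \<le> int (length xs) then xs ! nat (p - 1) else Suc n)"

lemma configuration_nth: "k < length xs \<Longrightarrow> configuration n xs (int k + 1) = xs ! k"
  by (simp add: configuration_def)

lemma configuration_trailing_empty_boxes:
  "configuration n (xs @ replicate k (Suc n)) = configuration n xs"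
  by (auto simp: configuration_def fun_eq_iff nth_append)

lemma configuration_ballE:
  assumes "configuration n xs p \<le> n"
  obtains k where "k < length xs" "p = int k + 1" "xs ! k = configuration n xs p"
proof -
  have "1 \<le> p" "p \<le> int (length xs)" "configuration n xs p = xs ! nat (p - 1)"
    using assms by (auto simp: configuration_def split: if_splits)
  then show ?thesis by (intro that[of "nat (p - 1)"]) auto
qed

lemma configuration_range:
  "set xs \<subseteq> {1..Suc n} \<Longrightarrow> configuration n xs p \<in> {1..Suc n}"
  by (auto simp: configuration_def subset_iff)

lemma ball_position_unique:
  assumes "distinct (ball_word n xs)" "j < length xs" "k < length xs" "xs ! j = xs ! k" "xs ! j \<le> n"
  shows "j = k"
proof -
  have False if "a < b" "b < length xs" "xs ! a = xs ! b" "xs ! a \<le> n" for a b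
  proof -
    have "distinct (ball_word n (take b xs @ drop b xs))" using assms(1) by simp
    moreover have "xs ! a \<in> set (take b xs)" "xs ! b \<in> set (drop b xs)"
      using that by (auto simp: in_set_conv_nth simp flip: Cons_nth_drop_Suc)
    ultimately show False using that by (auto simp del: append_take_drop_id)
  qed
  then show ?thesis using assms by (metis linorder_neqE_nat)
qed

lemma configuration_ball_unique:
  assumes "distinct (ball_word n xs)" "configuration n xs p = configuration n xs q"
    "configuration n xs p \<le> n"
  shows "p = q"
  using assms by (metis ball_position_unique configuration_ballE)

lemma configuration_ex1:
  assumes "distinct (ball_word n xs)" "i \<in> set xs" "i \<le> n"
  shows "\<exists>!p. configuration n xs p = i"
  using assms configuration_ball_unique configuration_nth by (metis in_set_conv_nth)

text \<open>
  A description of the result of a move that does not refer to the order of the jumps: every ball goes to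
  the right, a box receives something larger than the ball it held, and whenever a ball passes a box
  that is free at its turn, that box has been taken by a smaller ball.
\<close>

lemma BB_from_positions:
  assumes range: "\<And>p. X p \<in> {1..Suc n}" "\<And>p. X' p \<in> {1..Suc n}"
    and ex1: "\<And>i. i \<in> {1..n} \<Longrightarrow> \<exists>!p. X p = i" "\<And>i. i \<in> {1..n} \<Longrightarrow> \<exists>!q. X' q = i"
    and larger: "\<And>p. X p \<le> n \<Longrightarrow> X p < X' p"
    and right: "\<And>p q. X p = X' q \<Longrightarrow> X p \<le> n \<Longrightarrow> p < q"
    and greedy: "\<And>p q r. X p = X' q \<Longrightarrow> X p \<le> n \<Longrightarrow> p < r \<Longrightarrow> r < q \<Longrightarrow>
      X r < X p \<or> X r = Suc n \<Longrightarrow> X' r < X p"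
  shows "BB n X = X'"
proof -
  \<comment> \<open>The configuration after the balls \<open>1, \<dots>, k\<close> have jumped: they are in their final boxes,
    the others in their initial ones.\<close>
  define Y where "Y k p = (if X' p \<le> k then X' p else if X p \<le> k then Suc n else X p)" for k p
  have jump: "jump n (Suc k) (Y k) = Y (Suc k)" if "k < n" for k
  proof -
    from ex1(1)[of "Suc k"] that obtain p where p: "\<And>r. X r = Suc k \<longleftrightarrow> r = p"
      by auto
    from ex1(2)[of "Suc k"] that obtain q where q: "\<And>r. X' r = Suc k \<longleftrightarrow> r = q"
      by auto
    have "p < q" using right[of p q] p[of p] q[of q] that by simp
    have p': "Suc k < X' p" using larger[of p] p[of p] that by simp
    have "Y k r = Suc k \<longleftrightarrow> r = p" for r
      using p[of r] p' that by (auto simp: Y_def)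
    then have the_p: "(THE r. Y k r = Suc k) = p" by auto
    have "X q = Suc n" if "\<not> X q \<le> k"
    proof -
      have "\<not> X q \<le> n" using larger[of q] q[of q] that by auto
      then show ?thesis using range(1)[of q] by auto
    qed
    then have "Y k q = Suc n" using q[of q] by (auto simp: Y_def)
    moreover have "q \<le> r" if r: "p < r" "Y k r = Suc n" for r
    proof (rule ccontr)
      assume "\<not> q \<le> r"
      then have "r < q" by simp
      have "k < X' r" "X r \<le> k \<or> X r = Suc n"
        using r(2) \<open>k < n\<close> by (auto simp: Y_def split: if_splits)
      then show False
        using greedy[of p q r] p[of p] q[of q] \<open>k < n\<close> r(1) \<open>r < q\<close> by auto
    qed
    ultimately have least_q: "(LEAST r. p < r \<and> Y k r = Suc n) = q"
      using \<open>p < q\<close> by (intro Least_equality) auto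
    have "((Y k)(p := Suc n, q := Suc k)) r = Y (Suc k) r" for r
      using p[of r] p' q[of r] q[of p] \<open>p < q\<close> by (auto simp: Y_def le_Suc_eq)
    then show ?thesis by (simp add: jump_def the_p least_q fun_eq_iff)
  qed
  have "fold (jump n) [1..<Suc k] X = Y k" if "k \<le> n" for k
    using that
  proof (induction k)
    case 0
    have "Y 0 p = X p" for p
      using range(1)[of p] range(2)[of p] by (auto simp: Y_def)
    then show ?case by (simp add: fun_eq_iff)
  next
    case (Suc k)
    then show ?case using jump[of k] by simp
  qed
  moreover have "Y n p = X' p" for p
    using range(1)[of p] range(2)[of p] by (auto simp: Y_def le_Suc_eq)
  ultimately show ?thesis by (simp add: BB_def fun_eq_iff)
qed

lemma emitted_nth:
  "k < length xs \<Longrightarrow> emitted n xs C ! k = unload n (xs ! k) (carrier n (take k xs) C)"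
proof (induction xs arbitrary: C k)
  case (Cons x xs)
  then show ?case by (cases k) auto
qed simp

lemma take_emitted: "take k (emitted n xs C) = emitted n (take k xs) C"
proof (induction xs arbitrary: C k)
  case (Cons x xs)
  then show ?case by (cases k) auto
qed simp

text \<open>
  The carrier at a box holds the balls that started to the left of it and have not yet been
  emitted; this turns the local properties of a sweep into statements about initial and final positions.
\<close>

lemma BB_emitted:
  assumes adm: "admissible n [] xs" and full: "{1..n} \<subseteq> set xs" and unloaded: "carrier n xs [] = []"
  shows "BB n (configuration n xs) = configuration n (emitted n xs [])"
proof -
  define ys where "ys = emitted n xs []"
  have len: "length ys = length xs" by (simp add: ys_def)
  have balls: "mset (ball_word n ys) = mset (ball_word n xs)"
    using carrier_conserves_balls[OF adm] unloaded by (simp add: ys_def)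
  have range: "set xs \<subseteq> {1..Suc n}" "set ys \<subseteq> {1..Suc n}"
    using adm set_emitted[OF adm] by (simp_all add: admissible_def ys_def)
  have dist: "distinct (ball_word n xs)" "distinct (ball_word n ys)"
    using adm mset_eq_imp_distinct_iff[OF balls] by (simp_all add: admissible_def)
  have full': "{1..n} \<subseteq> set ys"
    using mset_eq_setD[OF balls] full by auto
  define C where "C k = carrier n (take k xs) []" for k
  have admC: "admissible n (C k) (xs ! k # drop (Suc k) xs)" if "k < length xs" for k
    using admissible_carrier[of n "[]" "take k xs" "drop k xs"] adm that
    by (simp add: C_def Cons_nth_drop_Suc)
  have y: "ys ! k = unload n (xs ! k) (C k)" if "k < length xs" for k
    using emitted_nth[OF that] by (simp add: ys_def C_def)
  have "mset (ball_word n (take k ys)) + mset (C k) = mset (ball_word n (take k xs))" for k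
    using carrier_conserves_balls[of n "[]" "take k xs"] adm admissible_prefix[of n "[]" "take k xs" "drop k xs"]
    by (simp add: C_def ys_def take_emitted)
  then have "set_mset (mset (ball_word n (take k ys)) + mset (C k))
      = set_mset (mset (ball_word n (take k xs)))" for k
    by (rule arg_cong)
  then have loaded: "(set (take k ys) \<inter> {..n}) \<union> set (C k) = set (take k xs) \<inter> {..n}" for k
    by simp
  have larger: "xs ! k < ys ! k" if "k < length xs" "xs ! k \<le> n" for k
    using unload_properties(2)[OF admC] y that by simp
  have right: "j < k" if "j < length xs" "k < length xs" "xs ! j = ys ! k" "xs ! j \<le> n" for j k
  proof -
    have "ys ! k \<in> set (C k)" using unload_properties(3)[OF admC] y that by simp
    then have "xs ! j \<in> set (take k xs)" using loaded[of k] that by auto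
    then obtain i where "i < k" "i < length xs" "xs ! i = xs ! j" by (auto simp: in_set_conv_nth)
    then show ?thesis using ball_position_unique[OF dist(1), of j i] that by auto
  qed
  have greedy: "ys ! r < xs ! j"
    if "j < r" "r < k" "k < length xs" "xs ! j = ys ! k" "xs ! j \<le> n" "xs ! r < xs ! j \<or> n < xs ! r"
    for j r k
  proof -
    have "xs ! j \<in> set (take r xs)" using that by (auto simp: in_set_conv_nth)
    moreover have "xs ! j \<notin> set (take r ys)"
    proof
      assume "xs ! j \<in> set (take r ys)"
      then obtain i where "i < r" "i < length ys" "ys ! i = xs ! j"
        by (auto simp: in_set_conv_nth)
      then show False using ball_position_unique[OF dist(2), of k i] that len by auto
    qed
    ultimately have "xs ! j \<in> set (C r)" using loaded[of r] that by auto
    then have "ys ! r \<le> xs ! j"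
      using unload_properties(4)[OF admC, of r "xs ! j"] y[of r] that by auto
    moreover have "ys ! r \<noteq> xs ! j"
      using ball_position_unique[OF dist(2), of k r] that len by auto
    ultimately show ?thesis by simp
  qed
  have "BB n (configuration n xs) = configuration n ys"
  proof (rule BB_from_positions)
    fix p q assume pq: "configuration n xs p = configuration n ys q" "configuration n xs p \<le> n"
    from pq(2) obtain j where j: "j < length xs" "p = int j + 1" "xs ! j = configuration n xs p"
      by (rule configuration_ballE)
    from pq obtain k where k: "k < length ys" "q = int k + 1" "ys ! k = configuration n ys q"
      using configuration_ballE by metis
    show "p < q" using right[of j k] j k pq len by simp
    fix r assume r: "p < r" "r < q"
      "configuration n xs r < configuration n xs p \<or> configuration n xs r = Suc n"
    define i where "i = nat (r - 1)"
    have i: "r = int i + 1" "j < i" "i < k" using r j k by (auto simp: i_def)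
    then show "configuration n ys r < configuration n xs p"
      using greedy[of j i k] configuration_nth[of i xs n] configuration_nth[of i ys n] r j k pq len
      by auto
  next
    fix p assume "configuration n xs p \<le> n"
    then obtain j where "j < length xs" "p = int j + 1" "xs ! j = configuration n xs p"
      by (rule configuration_ballE)
    then show "configuration n xs p < configuration n ys p"
      using larger[of j] configuration_nth[of j ys n] len \<open>configuration n xs p \<le> n\<close> by simp
  next
    fix i assume "i \<in> {1..n}"
    then have "i \<in> set xs" "i \<in> set ys" "i \<le> n" using full full' by auto
    then show "\<exists>!p. configuration n xs p = i" "\<exists>!p. configuration n ys p = i"
      using configuration_ex1 dist by blast+
  qed (use configuration_range range in blast)+
  then show ?thesis by (simp add: ys_def)
qed

lemma BB_move:
  assumes "admissible n [] xs" "{1..n} \<subseteq> set xs"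
  shows "BB n (configuration n xs) = configuration n (move n xs)"
proof -
  define zs where "zs = xs @ replicate (length (carrier n xs [])) (Suc n)"
  have "admissible n [] zs" using assms(1) by (auto simp: zs_def admissible_def)
  moreover have "{1..n} \<subseteq> set zs" using assms(2) by (auto simp: zs_def)
  moreover have "carrier n zs [] = []"
    by (simp add: zs_def carrier_append carrier_of_empty_boxes)
  ultimately have "BB n (configuration n zs) = configuration n (emitted n zs [])"
    by (rule BB_emitted)
  then show ?thesis
    unfolding move_eq_emitted[of n xs] zs_def[symmetric]
    by (simp add: zs_def configuration_trailing_empty_boxes)
qed

lemma move_iterate_full:
  assumes "admissible n [] xs" "{1..n} \<subseteq> set xs"
  shows "{1..n} \<subseteq> set ((move n ^^ t) xs)"
  using mset_eq_setD[OF ball_word_move_iterate[OF assms(1)], of t] assms(2) by auto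

lemma BB_iterate_move:
  assumes "admissible n [] xs" "{1..n} \<subseteq> set xs"
  shows "(BB n ^^ t) (configuration n xs) = configuration n ((move n ^^ t) xs)"
proof (induction t)
  case (Suc t)
  then show ?case
    using BB_move[OF admissible_move_iterate[OF assms(1)] move_iterate_full[OF assms]] by simp
qed simp

section \<open>Runs of configurations\<close>

lemma increasing_run_configuration:
  assumes "xs = u @ r @ v" "r \<noteq> []" "sorted_wrt (<) r" "set r \<subseteq> {1..n}"
    and left: "u = [] \<or> hd r < last u" and right: "v = [] \<or> hd v = Suc n \<or> hd v < last r"
  shows "\<exists>a. increasing_run n (configuration n xs) a (int (length u + length r)) \<and>
    balls (configuration n xs) a (int (length u + length r)) = r"
proof -
  define a where "a = int (length u) + 1"
  define b where "b = int (length u + length r)"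
  define X where "X = configuration n xs"
  have "a \<le> b" using assms(2) by (cases r) (auto simp: a_def b_def)
  have X: "X (a + int k) = r ! k" if "k < length r" for k
    using configuration_nth[of "length u + k" xs n] that assms(1)
    by (simp add: X_def a_def nth_append add_ac)
  have X': "X p = r ! nat (p - a)" "nat (p - a) < length r" if "p \<in> {a..b}" for p
    using X[of "nat (p - a)"] that by (auto simp: a_def b_def)
  have bl: "balls X a b = r"
    using X by (intro nth_equalityI) (auto simp: balls_def a_def b_def)
  have block: "increasing_block n X a b"
    unfolding increasing_block_def
  proof (intro conjI ballI strict_mono_onI)
    show "X p \<in> {1..n}" if "p \<in> {a..b}" for p
      using X'[OF that] assms(4) nth_mem by (metis subsetD)
    show "X p < X q" if "p \<in> {a..b}" "q \<in> {a..b}" "p < q" for p q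
      using X'[OF that(1)] X'[OF that(2)] that
        sorted_wrt_nth_less[OF assms(3), of "nat (p - a)" "nat (q - a)"]
      by auto
  qed fact
  have Xa: "X a = hd r" and Xb: "X b = last r"
    using X[of 0] X[of "length r - 1"] assms(2)
    by (auto simp: hd_conv_nth last_conv_nth a_def b_def of_nat_diff Suc_le_eq)
  have "increasing_run n X a b"
    unfolding increasing_run_def
  proof (intro conjI block allI impI; elim conjE)
    fix a' b' assume blk: "increasing_block n X a' b'" and sub: "{a..b} \<subseteq> {a'..b'}"
    then have sub': "a' \<le> a" "b \<le> b'" using \<open>a \<le> b\<close> by auto
    show "a' = a"
    proof (rule ccontr)
      assume "a' \<noteq> a"
      then have "X (a - 1) \<le> n" "X (a - 1) < X a"
        using blk sub' \<open>a \<le> b\<close> by (auto simp: increasing_block_def strict_mono_on_def)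
      moreover have "X (a - 1) = (if u = [] then Suc n else last u)"
        using assms(1)
        by (cases u rule: rev_cases) (auto simp: X_def a_def configuration_def nth_append)
      ultimately show False using left Xa by (auto split: if_splits)
    qed
    show "b' = b"
    proof (rule ccontr)
      assume "b' \<noteq> b"
      then have "X (b + 1) \<le> n" "X b < X (b + 1)"
        using blk sub' \<open>a \<le> b\<close> by (auto simp: increasing_block_def strict_mono_on_def)
      moreover have "X (b + 1) = (if v = [] then Suc n else hd v)"
        using configuration_nth[of "length u + length r" xs n] assms(1)
        by (auto simp: X_def b_def configuration_def nth_append hd_conv_nth nat_add_distrib)
      ultimately show False using right Xb by (auto split: if_splits)
    qed
  qed
  then show ?thesis using bl unfolding X_def b_def by blast
qed

text \<open>
  The union of two increasing blocks with a common box is an increasing block, so maximality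
  forces equality.
\<close>

lemma increasing_runs_overlap:
  assumes "increasing_run n X a b" "increasing_run n X a' b'" "p \<in> {a..b}" "p \<in> {a'..b'}"
  shows "a = a' \<and> b = b'"
proof -
  define c d where "c = min a a'" and "d = max b b'"
  have un: "{c..d} = {a..b} \<union> {a'..b'}" using assms(3,4) by (auto simp: c_def d_def)
  have blocks: "increasing_block n X a b" "increasing_block n X a' b'"
    using assms by (auto simp: increasing_run_def)
  have "increasing_block n X c d"
    unfolding increasing_block_def
  proof (intro conjI strict_mono_onI ballI)
    show "c \<le> d" using assms(3) by (auto simp: c_def d_def)
    show "X q \<in> {1..n}" if "q \<in> {c..d}" for q
      using that blocks unfolding un increasing_block_def by blast
    have within: "X q < X r" if "q < r" "{q, r} \<subseteq> {a..b} \<or> {q, r} \<subseteq> {a'..b'}" for q r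
      using that blocks unfolding increasing_block_def strict_mono_on_def by blast
    show "X q < X r" if "q \<in> {c..d}" "r \<in> {c..d}" "q < r" for q r
    proof (cases "{q, r} \<subseteq> {a..b} \<or> {q, r} \<subseteq> {a'..b'}")
      case False
      then have "q < p" "p < r" "{q, p} \<subseteq> {a..b} \<or> {q, p} \<subseteq> {a'..b'}"
        "{p, r} \<subseteq> {a..b} \<or> {p, r} \<subseteq> {a'..b'}"
        using that assms(3,4) unfolding un by auto
      then show ?thesis using within[of q p] within[of p r] by simp
    qed (use within that in blast)
  qed
  then show ?thesis using assms(1,2) un unfolding increasing_run_def by blast
qed

section \<open>The rightmost soliton\<close>

lemma first_row_of_insertion_tableau:
  assumes "xs \<noteq> []" "set xs \<subseteq> {1..n}"
  shows "hd (insertion_tableau xs) = carrier n xs []"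
proof -
  have row: "hd (fold tableau_insert ys (r # rs)) = carrier n ys r" if "set ys \<subseteq> {1..n}" for ys r rs
    using that
    by (induction ys arbitrary: r rs) (auto simp: load_def split: prod.split option.split)
  obtain y ys where "xs = y # ys" using assms(1) by (cases xs) auto
  then show ?thesis
    using row[of ys "[y]" "[]"] assms(2) by (simp add: insertion_tableau_def load_def)
qed

theorem theorem2:
  fixes n :: nat and w :: "nat \<Rightarrow> nat" and X :: "int \<Rightarrow> nat"
  assumes "n \<ge> 1"
    and "w permutes {1..n}"
    and "X = perm_config n w"
  shows "(\<exists>!S. bbs_rightmost_soliton n X S) \<and>
         (\<forall>S. bbs_rightmost_soliton n X S \<longrightarrow>
            (\<forall>t\<ge>1. rightmost_run n ((BB n ^^ t) X) S) \<and>
            S = hd (insertion_tableau (one_line n w)))"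
proof -
  define xs where "xs = one_line n w"
  define R where "R = carrier n xs []"
  define Z where "Z t = (BB n ^^ t) X" for t
  define ws where "ws t = (move n ^^ t) xs" for t
  have set_xs: "set xs = {1..n}"
    using permutes_image[OF assms(2)] 
    by (simp add: xs_def one_line_def atLeastLessThanSuc_atLeastAtMost del: upt_Suc)
  have "distinct xs"
    using permutes_inj_on[OF assms(2)] by (simp add: xs_def one_line_def distinct_map del: upt_Suc)
  then have adm: "admissible n [] xs" using set_xs by (auto simp: admissible_def ball_word_id)
  have "xs \<noteq> []" using assms(1) set_xs by auto
  then have "last xs \<le> n" using set_xs last_in_set by fastforce
  have "X = configuration n xs"
    using assms(3)
    by (auto simp: fun_eq_iff perm_config_def configuration_def xs_def one_line_def nat_diff_distrib
        simp del: upt_Suc)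
  then have Z: "Z t = configuration n (ws t)" for t
    using BB_iterate_move[OF adm] set_xs by (simp add: Z_def ws_def)
  have Z_add: "(BB n ^^ s) (Z t) = Z (s + t)" for s t by (simp add: Z_def funpow_add)
  note adm_ws = admissible_move_iterate[OF adm, folded ws_def]
  have ws_end: "ws t \<noteq> []" "last (ws t) \<in> {1..n}" for t
  proof -
    have "ws t \<noteq> []" "last (ws t) \<le> n"
      using move_iterate_ends_with_ball[OF adm \<open>xs \<noteq> []\<close> \<open>last xs \<le> n\<close>, of t]
      by (simp_all add: ws_def)
    moreover from this have "last (ws t) \<in> {1..Suc n}"
      using adm_ws[of t] last_in_set unfolding admissible_def by blast
    ultimately show "ws t \<noteq> []" "last (ws t) \<in> {1..n}" by auto
  qed
  have ws_dist: "distinct (ball_word n (ws t))" for t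
    using adm_ws by (simp add: admissible_def)
  have R: "R = carrier n (ws t) []" for t
    using final_carrier_permutation_stable[OF adm] set_xs by (simp add: R_def ws_def)
  have ball_bound: "p \<le> int (length (ws t))" if "Z t p \<in> {1..n}" for t p
    using that by (auto simp: Z configuration_def split: if_splits)
  have Z_last: "Z t (int (length (ws t))) = last (ws t)" for t
    using ws_end(1)[of t] by (simp add: Z configuration_def last_conv_nth nat_diff_distrib Suc_le_eq)
  \<comment> \<open>Every move ends by unloading the final carrier, which is always \<open>R\<close>.\<close>
  have run_R: "\<exists>a. increasing_run n (Z (Suc t)) a (int (length (ws (Suc t)))) \<and>
      balls (Z (Suc t)) a (int (length (ws (Suc t)))) = R" for t
  proof -
    define u where "u = emitted n (ws t) []"
    have ws: "ws (Suc t) = u @ R @ []" using R[of t] by (simp add: ws_def move_def u_def)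
    have "last (ws t) \<le> n" using ws_end(2)[of t] by simp
    note E = last_emitted_greater[OF adm_ws[of t] ws_end(1)[of t] this, folded R[of t]]
    have "R \<noteq> []" using E(3) by auto
    moreover have "hd R < last u" using E(1,2) by (simp add: u_def)
    moreover have "sorted_wrt (<) R" "set R \<subseteq> {1..n}"
      using final_carrier_properties[OF adm_ws[of t], folded R[of t]] by simp_all
    ultimately show ?thesis
      using increasing_run_configuration[OF ws, of n] unfolding Z by (simp add: ws)
  qed
  have run_end: "b \<le> int (length (ws t))" if "increasing_run n (Z t) a b" for t a b
    using that ball_bound[of t b] by (auto simp: increasing_run_def increasing_block_def)

  have "bbs_rightmost_soliton n X R"
  proof -
    obtain T rs where T: "\<And>t. t \<ge> T \<Longrightarrow> runs_of n (ws t) rs"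
      using eventually_constant_runs[OF adm] by (auto simp: ws_def)
    have run_r: "\<exists>a b. increasing_run n (Z t) a b \<and> balls (Z t) a b = r"
      if later: "t \<ge> T" "r \<in> set rs" for t r
    proof -
      obtain u v where "ws t = u @ r @ v" "r \<noteq> []" "sorted_wrt (<) r" "set r \<subseteq> {1..n}"
        "u = [] \<or> hd r < last u" "v = [] \<or> hd v = Suc n \<or> hd v < last r"
        using runs_of_member[OF T[OF later(1)] later(2)] by blast
      then show ?thesis unfolding Z using increasing_run_configuration by blast
    qed
    have "\<exists>a b. soliton n (Z (Suc T)) a b \<and> i \<in> set (balls (Z (Suc T)) a b)"
      if "i \<in> {1..n}" for i
    proof -
      have "i \<in> set (ball_word n (ws (Suc T)))"
        using move_iterate_full[OF adm, of "Suc T"] set_xs that by (auto simp: ws_def)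
      then obtain r where r: "r \<in> set rs" "i \<in> set r"
        using runs_of_balls[OF T[of "Suc T"]] by auto
      obtain a b where "increasing_run n (Z (Suc T)) a b" "balls (Z (Suc T)) a b = r"
        using run_r[of "Suc T" r] r by auto
      moreover have "\<exists>a' b'. increasing_run n (Z (s + Suc T)) a' b' \<and>
          balls (Z (s + Suc T)) a' b' = r" for s
        using run_r[of "s + Suc T" r] r by simp
      ultimately have "soliton n (Z (Suc T)) a b" unfolding soliton_def Z_add by blast
      then show ?thesis using \<open>balls (Z (Suc T)) a b = r\<close> r by blast
    qed
    then have "steady_state n (Z (Suc T))" by (simp add: steady_state_def)
    moreover have "rightmost_soliton n (Z (Suc T)) R"
    proof -
      obtain a where a: "increasing_run n (Z (Suc T)) a (int (length (ws (Suc T))))"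
        "balls (Z (Suc T)) a (int (length (ws (Suc T)))) = R" using run_R by blast
      moreover have "\<exists>a' b'. increasing_run n (Z (s + Suc T)) a' b' \<and>
          balls (Z (s + Suc T)) a' b' = R" for s
        using run_R[of "s + T"] by auto
      ultimately have "soliton n (Z (Suc T)) a (int (length (ws (Suc T))))"
        unfolding soliton_def Z_add by blast
      moreover have "b' \<le> int (length (ws (Suc T)))" if "soliton n (Z (Suc T)) a' b'" for a' b'
        using that run_end unfolding soliton_def by blast
      ultimately show ?thesis using a unfolding rightmost_soliton_def by blast
    qed
    ultimately show ?thesis unfolding bbs_rightmost_soliton_def Z_def by blast
  qed
  moreover have "S = R" if rightmost: "bbs_rightmost_soliton n X S" for S
  proof -
    obtain t a b where steady: "steady_state n (Z t)" and sol: "soliton n (Z t) a b"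
      and S: "S = balls (Z t) a b" and max: "\<And>a' b'. soliton n (Z t) a' b' \<Longrightarrow> b' \<le> b"
      using rightmost unfolding bbs_rightmost_soliton_def rightmost_soliton_def Z_def by blast
    \<comment> \<open>The rightmost ball: in steady state it belongs to the rightmost soliton, and one move
      later it belongs to \<open>R\<close>.\<close>
    define x where "x = last (ws t)"
    have x: "x \<in> {1..n}" using ws_end by (simp add: x_def)
    obtain a0 b0 where "soliton n (Z t) a0 b0" "x \<in> set (balls (Z t) a0 b0)"
      using steady x unfolding steady_state_def by blast
    then obtain p where p: "p \<le> b0" "Z t p = x" "b0 \<le> b" using max by (auto simp: balls_def)
    have "p = int (length (ws t))"
      using configuration_ball_unique[OF ws_dist, of t p "int (length (ws t))"] p(2) Z_last[of t] x
      by (simp add: Z x_def)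
    moreover have run: "increasing_run n (Z t) a b" using sol by (simp add: soliton_def)
    ultimately have "b = int (length (ws t))" using run_end[OF run] p by simp
    then have "Z t b = x" "a \<le> b"
      using run Z_last[of t] by (auto simp: x_def increasing_run_def increasing_block_def)
    then have "x \<in> set S" by (auto simp: S balls_def intro!: image_eqI[of _ _ b])
    moreover obtain a' b' where S': "increasing_run n (Z (Suc t)) a' b'" "balls (Z (Suc t)) a' b' = S"
    proof -
      have "\<exists>a' b'. increasing_run n ((BB n ^^ 1) (Z t)) a' b' \<and> balls ((BB n ^^ 1) (Z t)) a' b' = S"
        using sol unfolding soliton_def S by blast
      then show ?thesis using that unfolding Z_add by auto
    qed
    ultimately obtain q where q: "q \<in> {a'..b'}" "Z (Suc t) q = x" by (auto simp: balls_def)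
    obtain c d where R': "increasing_run n (Z (Suc t)) c d" "balls (Z (Suc t)) c d = R"
      using run_R by blast
    have "x \<in> set R"
      using last_emitted_greater(3)[OF adm_ws[of t] ws_end(1)[of t]] x unfolding R[of t]
      by (simp add: x_def)
    then obtain q' where q': "q' \<in> {c..d}" "Z (Suc t) q' = x" using R'(2) by (auto simp: balls_def)
    have "q = q'"
      using configuration_ball_unique[OF ws_dist, of "Suc t" q q'] q q' x by (simp add: Z)
    then show ?thesis using increasing_runs_overlap[OF S'(1) R'(1)] q q' S'(2) R'(2) by blast
  qed
  moreover have "rightmost_run n ((BB n ^^ t) X) R" if "t \<ge> 1" for t
  proof -
    have "Suc (t - 1) = t" using that by simp
    then obtain a where "increasing_run n (Z t) a (int (length (ws t)))"
      "balls (Z t) a (int (length (ws t))) = R" using run_R[of "t - 1"] by auto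
    then show ?thesis using run_end[of t] unfolding rightmost_run_def Z_def[symmetric] by blast
  qed
  moreover have "R = hd (insertion_tableau (one_line n w))"
    using first_row_of_insertion_tableau[of xs n] set_xs \<open>xs \<noteq> []\<close> by (simp add: R_def xs_def)
  ultimately show ?thesis by blast
qed

end
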